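(* Let $p,g_1,\ldots,g_m$ be real polynomials in $x=(x_1,\ldots,x_n)$, consider the polynomial optimization problem $\inf_{x\in S}p(x)$ with feasible set $S=\{x\in\mathbb{R}^n : g_i(x)\ge 0,\ i=1,\ldots,m\}$, and let $d$ be such that $2d$ is the smallest even integer larger than or equal to the maximum degree of $p,g_1,\ldots,g_m$. Suppose $S\subseteq B(0,R)$ for some positive scalar $R$. Let $\eta_1,\ldots,\eta_m$ (resp. $\beta$) be any finite upper bounds on $g_1(x),\ldots,g_m(x)$ (resp. $-p(x)$) over $S$. Then a scalar $\gamma$ is a strict lower bound on the problem (that is, $p(x)>\gamma$ for all $x\in S$) if and only if the homogeneous sum of squares polynomial $$f_\gamma(x,s,y):=\left(\gamma y^{2d}-y^{2d}p(x/y)-s_0^2y^{2d-2}\right)^2+\sum_{i=1}^m\left(y^{2d}g_i(x/y)-s_i^2y^{2d-2}\right)^2+\left(\Big(R+\sum_{i=1}^m\eta_i+\beta+\gamma\Big)^dy^{2d}-\Big(\sum_{i=1}^n x_i^2+\sum_{i=0}^m s_i^2\Big)^d-s_{m+1}^{2d}\right)^2$$ of degree $4d$ in the $n+m+3$ variables $(x_1,\ldots,x_n,s_0,\ldots,s_m,s_{m+1},y)$ is positive definite.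
   Context: $B(0,R)$ denotes the ball of radius $R$ centered at the origin. A form is a homogeneous polynomial; a form $f$ is positive definite if $f(z)>0$ for all nonzero $z$. For a polynomial $q$ of degree at most $2d$, $y^{2d}q(x/y)$ denotes the polynomial in $(x,y)$ obtained by homogenizing $q$ to degree $2d$ with the variable $y$.
   Formalization: The ball containing S is taken to have radius √R (so Σx_i² ≤ R on S) instead of R, since with radius R and the constant R in f_γ the equivalence fails (e.g. g_1 = −(x−2)², p = 0, R = 2, η_1 = β = γ = 0); d ≥ 1 is assumed so that y^{2d−2} is a polynomial. *)

theory Defs
  imports "HOL-Analysis.Analysis" "HOL-Library.Poly_Mapping"
begin

text \<open>
  Real polynomials in variables indexed by a finite type \<open>'v\<close> are finitely supported maps from
  monomials (finitely supported exponent vectors) to coefficients; ring operations are those of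
  \<^theory>\<open>HOL-Library.Poly_Mapping\<close> (convolution product).
\<close>

type_synonym 'v monomial = "'v \<Rightarrow>\<^sub>0 nat"
type_synonym 'v polynomial = "'v monomial \<Rightarrow>\<^sub>0 real"

definition Const :: "real \<Rightarrow> 'v polynomial" where
  "Const c = Poly_Mapping.single 0 c"

definition Var :: "'v \<Rightarrow> 'v polynomial" where
  "Var v = Poly_Mapping.single (Poly_Mapping.single v 1) 1"

definition mono_degree :: "'v::finite monomial \<Rightarrow> nat" where
  "mono_degree t = (\<Sum>v\<in>UNIV. Poly_Mapping.lookup t v)"

text \<open>The zero polynomial gets degree 0.\<close>

definition total_degree :: "'v::finite polynomial \<Rightarrow> nat" where
  "total_degree q = Max (insert 0 (mono_degree ` Poly_Mapping.keys q))"

definition peval :: "'v::finite polynomial \<Rightarrow> real ^ 'v \<Rightarrow> real" where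
  "peval q z = (\<Sum>t\<in>Poly_Mapping.keys q.
     Poly_Mapping.lookup q t * (\<Prod>v\<in>UNIV. (z $ v) ^ Poly_Mapping.lookup t v))"

definition is_form :: "'v::finite polynomial \<Rightarrow> bool" where
  "is_form q \<longleftrightarrow> (\<exists>k. \<forall>t\<in>Poly_Mapping.keys q. mono_degree t = k)"

definition is_sos :: "'v polynomial \<Rightarrow> bool" where
  "is_sos q \<longleftrightarrow> (\<exists>hs :: 'v polynomial list. q = (\<Sum>h\<leftarrow>hs. h\<^sup>2))"

definition positive_definite :: "'v::finite polynomial \<Rightarrow> bool" where
  "positive_definite q \<longleftrightarrow> (\<forall>z. z \<noteq> 0 \<longrightarrow> peval q z > 0)"

definition feasible_set :: "('m \<Rightarrow> 'n::finite polynomial) \<Rightarrow> (real ^ 'n) set" where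
  "feasible_set g = {x. \<forall>i. peval (g i) x \<ge> 0}"

text \<open>
  The variables of the certificate polynomial: \<open>VX i\<close> is \<open>x\<^sub>i\<close>, \<open>VS0\<close> is \<open>s\<^sub>0\<close>, \<open>VS i\<close> is the
  slack \<open>s\<^sub>i\<close> of the constraint \<open>g\<^sub>i\<close>, \<open>VSlast\<close> is \<open>s\<^sub>m\<^sub>+\<^sub>1\<close> and \<open>VY\<close> is \<open>y\<close>. Here \<open>n\<close> and \<open>m\<close> are the
  cardinalities of the index types \<open>'n\<close> and \<open>'m\<close>.
\<close>

datatype ('n, 'm) cvar = VX 'n | VS0 | VS 'm | VSlast | VY

lemma UNIV_cvar:
  "(UNIV :: ('n, 'm) cvar set) = VX ` UNIV \<union> VS ` UNIV \<union> {VS0, VSlast, VY}"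
proof -
  have "v \<in> VX ` UNIV \<union> VS ` UNIV \<union> {VS0, VSlast, VY}" for v :: "('n, 'm) cvar"
    by (cases v) auto
  then show ?thesis by blast
qed

instance cvar :: (finite, finite) finite
  by standard (simp add: UNIV_cvar)

lemma card_cvar: "CARD(('n::finite, 'm::finite) cvar) = CARD('n) + CARD('m) + 3"
proof -
  have "card (VX ` UNIV \<union> VS ` UNIV :: ('n, 'm) cvar set) = CARD('n) + CARD('m)"
    by (subst card_Un_disjoint) (auto simp: card_image inj_on_def)
  moreover have "card {VS0, VSlast, VY :: ('n, 'm) cvar} = 3" by simp
  ultimately show ?thesis
    unfolding UNIV_cvar by (subst card_Un_disjoint) auto
qed

text \<open>
  \<open>homogenize D q\<close> is \<open>y\<^sup>D q(x/y)\<close>, meaningful when the degree of \<open>q\<close> is at most \<open>D\<close> (otherwise the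
  subtraction truncates).
\<close>

definition homogenize :: "nat \<Rightarrow> 'n::finite polynomial \<Rightarrow> ('n, 'm) cvar polynomial" where
  "homogenize D q = (\<Sum>t\<in>Poly_Mapping.keys q. Const (Poly_Mapping.lookup q t)
     * (\<Prod>i\<in>UNIV. Var (VX i) ^ Poly_Mapping.lookup t i) * Var VY ^ (D - mono_degree t))"

text \<open>The exponent \<open>2 * d - 2\<close> is the intended one for \<open>d \<ge> 1\<close>.\<close>

definition certificate_poly ::
  "nat \<Rightarrow> real \<Rightarrow> ('m::finite \<Rightarrow> real) \<Rightarrow> real \<Rightarrow> 'n::finite polynomial \<Rightarrow> ('m \<Rightarrow> 'n polynomial)
     \<Rightarrow> real \<Rightarrow> ('n, 'm) cvar polynomial"
where
  "certificate_poly d R \<eta> \<beta> p g \<gamma> =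
     (Const \<gamma> * Var VY ^ (2 * d) - homogenize (2 * d) p - (Var VS0)\<^sup>2 * Var VY ^ (2 * d - 2))\<^sup>2
     + (\<Sum>i\<in>UNIV. (homogenize (2 * d) (g i) - (Var (VS i))\<^sup>2 * Var VY ^ (2 * d - 2))\<^sup>2)
     + (Const ((R + (\<Sum>i\<in>UNIV. \<eta> i) + \<beta> + \<gamma>) ^ d) * Var VY ^ (2 * d)
        - ((\<Sum>i\<in>UNIV. (Var (VX i))\<^sup>2) + ((Var VS0)\<^sup>2 + (\<Sum>i\<in>UNIV. (Var (VS i))\<^sup>2))) ^ d
        - Var VSlast ^ (2 * d))\<^sup>2"

text \<open>
  Convention for the ball: \<open>R\<close> enters \<^const>\<open>certificate_poly\<close> as a bound on \<open>\<Sum>\<^sub>i x\<^sub>i\<^sup>2\<close>, so the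
  ball \<open>B(0,R)\<close> that contains the feasible set has to be \<open>{x. \<Sum>\<^sub>i x\<^sub>i\<^sup>2 \<le> R}\<close>, i.e.
  \<open>cball 0 (sqrt R)\<close>. With \<open>cball 0 R\<close> in its place the equivalence fails for \<open>R > 1\<close>: take
  \<open>n = m = 1\<close>, \<open>g\<^sub>1 = -(x - 2)\<^sup>2\<close>, \<open>p = 0\<close>, \<open>R = 2\<close> and \<open>\<eta>\<^sub>1 = \<beta> = \<gamma> = 0\<close>.
\<close>

end

theory Submission
  imports Defs
begin

text \<open>
  Let \<open>f\<close> be the certificate polynomial. It is a sum of squares of forms of degree \<open>2 d\<close>, hence
  nonnegative, and it fails to be positive definite exactly when the squared forms have a common
  zero \<open>(x, s, y) \<noteq> 0\<close>. Such a zero is the same thing, up to scaling, as a feasible point with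
  objective value at most \<open>\<gamma>\<close>.

  If \<open>y = 0\<close>, the last form reduces to \<open>- (\<Sum> x\<^sub>i\<^sup>2 + \<Sum> s\<^sub>i\<^sup>2) ^ d - s\<^sub>m\<^sub>+\<^sub>1 ^ (2 d)\<close>, which vanishes only
  at the origin; this is what the last square is for. If \<open>y \<noteq> 0\<close>, dividing the other forms by
  \<open>y ^ (2 d)\<close> gives \<open>\<gamma> - p (x/y) = (s\<^sub>0/y)\<^sup>2\<close> and \<open>g\<^sub>i (x/y) = (s\<^sub>i/y)\<^sup>2\<close>, so \<open>x/y\<close> is feasible and
  \<open>p (x/y) \<le> \<gamma>\<close>. Conversely, for a feasible \<open>x\<close> with \<open>p x \<le> \<gamma>\<close> one takes \<open>y = 1\<close> and the square
  roots \<open>s\<^sub>0 = sqrt (\<gamma> - p x)\<close>, \<open>s\<^sub>i = sqrt (g\<^sub>i x)\<close>. The ball and the bounds \<open>\<eta>\<close>, \<open>\<beta>\<close> give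
  \<open>\<Sum> x\<^sub>i\<^sup>2 + \<Sum> s\<^sub>i\<^sup>2 \<le> R + \<Sum> \<eta>\<^sub>i + \<beta> + \<gamma>\<close>, so that the gap between the \<open>d\<close>-th powers of the two
  sides is nonnegative and is of the form \<open>s\<^sub>m\<^sub>+\<^sub>1 ^ (2 d)\<close>: the last form can be made to vanish too.

  The degree of \<open>f\<close> is \<open>4 d\<close> because all its monomials have that degree and there is at least one:
  the last square is \<open>1\<close> at the unit vector of the variable \<open>s\<^sub>m\<^sub>+\<^sub>1\<close>.

  The facts that support this are that evaluation is a ring homomorphism (\<open>peval_add\<close>,
  \<open>peval_mult\<close>), that \<open>homogenize\<close> evaluates to \<open>y ^ D * q (x/y)\<close> (\<open>peval_homogenize\<close>), and the
  closure of homogeneous polynomials of a given degree under the ring operations.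
\<close>

section \<open>Evaluation is a ring homomorphism\<close>

definition monomial_value :: "real ^ 'v \<Rightarrow> 'v::finite monomial \<Rightarrow> real" where
  "monomial_value z t = (\<Prod>v\<in>UNIV. (z $ v) ^ Poly_Mapping.lookup t v)"

lemma monomial_value_zero [simp]: "monomial_value z 0 = 1"
  by (simp add: monomial_value_def)

lemma monomial_value_add: "monomial_value z (s + t) = monomial_value z s * monomial_value z t"
  by (simp add: monomial_value_def lookup_add power_add prod.distrib)

lemma monomial_value_single: "monomial_value z (Poly_Mapping.single v 1) = z $ v"
proof -
  have "monomial_value z (Poly_Mapping.single v 1) = (\<Prod>w\<in>UNIV. if w = v then z $ w else 1)"
    unfolding monomial_value_def by (intro prod.cong) (auto simp: lookup_single when_def)
  then show ?thesis by simp
qed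

text \<open>
  Summing over any finite superset of the support makes evaluations of different polynomials
  comparable term by term.
\<close>

lemma peval_superset:
  assumes "finite A" "Poly_Mapping.keys q \<subseteq> A"
  shows "peval q z = (\<Sum>t\<in>A. Poly_Mapping.lookup q t * monomial_value z t)"
  unfolding peval_def monomial_value_def
  by (intro sum.mono_neutral_left) (use assms in \<open>auto simp: in_keys_iff\<close>)

lemma peval_zero [simp]: "peval 0 z = 0"
  by (simp add: peval_def)

lemma peval_single: "peval (Poly_Mapping.single t c) z = c * monomial_value z t"
  by (subst peval_superset[of "{t}"]) auto

lemma peval_add: "peval (q + r) z = peval q z + peval r z"
proof -
  let ?A = "Poly_Mapping.keys q \<union> Poly_Mapping.keys r"
  show ?thesis
    using keys_add[of q r]
    by (simp add: peval_superset[of ?A] lookup_add sum.distrib ring_distribs)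
qed

lemma peval_diff: "peval (q - r) z = peval q z - peval r z"
  using peval_add[of "q - r" r z] by simp

lemma peval_sum: "peval (\<Sum>i\<in>I. q i) z = (\<Sum>i\<in>I. peval (q i) z)"
  by (induction I rule: infinite_finite_induct) (simp_all add: peval_add)

lemma poly_mapping_eq_sum_single:
  "q = (\<Sum>t\<in>Poly_Mapping.keys q. Poly_Mapping.single t (Poly_Mapping.lookup q t))"
  by (rule poly_mapping_eqI)
    (simp add: lookup_sum lookup_single when_def in_keys_iff)

lemma peval_mult: "peval (q * r) z = peval q z * peval r z"
proof -
  let ?S = "\<lambda>q t. Poly_Mapping.single t (Poly_Mapping.lookup q t)"
  have "q * r = (\<Sum>t\<in>Poly_Mapping.keys q. ?S q t) * (\<Sum>u\<in>Poly_Mapping.keys r. ?S r u)"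
    using poly_mapping_eq_sum_single[of q] poly_mapping_eq_sum_single[of r] by simp
  also have "\<dots> = (\<Sum>t\<in>Poly_Mapping.keys q. \<Sum>u\<in>Poly_Mapping.keys r. ?S q t * ?S r u)"
    by (rule sum_product)
  finally have "peval (q * r) z
      = (\<Sum>t\<in>Poly_Mapping.keys q. \<Sum>u\<in>Poly_Mapping.keys r. peval (?S q t * ?S r u) z)"
    by (simp add: peval_sum)
  also have "\<dots> = (\<Sum>t\<in>Poly_Mapping.keys q. \<Sum>u\<in>Poly_Mapping.keys r.
      (Poly_Mapping.lookup q t * monomial_value z t) * (Poly_Mapping.lookup r u * monomial_value z u))"
    by (simp add: mult_single peval_single monomial_value_add mult_ac)
  also have "\<dots> = peval q z * peval r z"
    by (simp add: sum_product peval_def monomial_value_def)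
  finally show ?thesis .
qed

lemma peval_one [simp]: "peval 1 z = 1"
  by (simp add: peval_single flip: single_one)

lemma peval_Const [simp]: "peval (Const c) z = c"
  by (simp add: Const_def peval_single)

lemma peval_Var [simp]: "peval (Var v) z = z $ v"
  unfolding Var_def peval_single monomial_value_single by simp

lemma peval_power: "peval (q ^ k) z = peval q z ^ k"
  by (induction k) (simp_all add: peval_mult)

lemma peval_prod: "peval (\<Prod>i\<in>I. q i) z = (\<Prod>i\<in>I. peval (q i) z)"
  by (induction I rule: infinite_finite_induct) (simp_all add: peval_mult)

lemmas peval_ring_hom = peval_add peval_diff peval_sum peval_mult peval_power peval_prod

section \<open>Homogeneous polynomials\<close>

definition homogeneous :: "nat \<Rightarrow> 'v::finite polynomial \<Rightarrow> bool" where
  "homogeneous k q \<longleftrightarrow> (\<forall>t\<in>Poly_Mapping.keys q. mono_degree t = k)"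

lemma mono_degree_add: "mono_degree (s + t) = mono_degree s + mono_degree t"
  by (simp add: mono_degree_def lookup_add sum.distrib)

lemma mono_degree_single: "mono_degree (Poly_Mapping.single v k) = k"
  by (simp add: mono_degree_def lookup_single when_def)

lemma homogeneous_add:
  assumes "homogeneous k q" "homogeneous k r"
  shows "homogeneous k (q + r)"
  using assms keys_add[of q r] unfolding homogeneous_def by blast

lemma homogeneous_diff:
  assumes "homogeneous k q" "homogeneous k r"
  shows "homogeneous k (q - r)"
proof -
  have "Poly_Mapping.keys (q - r) \<subseteq> Poly_Mapping.keys q \<union> Poly_Mapping.keys r"
    by (auto simp: in_keys_iff lookup_minus)
  with assms show ?thesis unfolding homogeneous_def by blast
qed

lemma homogeneous_sum:
  assumes "\<And>i. i \<in> I \<Longrightarrow> homogeneous k (q i)"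
  shows "homogeneous k (\<Sum>i\<in>I. q i)"
  using assms
  by (induction I rule: infinite_finite_induct)
    (simp_all add: homogeneous_add, simp_all add: homogeneous_def)

lemma homogeneous_mult:
  assumes "homogeneous k q" "homogeneous l r" "n = k + l"
  shows "homogeneous n (q * r)"
  using assms keys_mult[of q r] unfolding homogeneous_def
  by (auto simp: mono_degree_add)

lemma homogeneous_Const: "homogeneous 0 (Const c)"
  by (simp add: homogeneous_def Const_def mono_degree_def)

lemma homogeneous_one: "homogeneous 0 1"
  by (simp add: homogeneous_def mono_degree_def)

lemma homogeneous_Var: "homogeneous 1 (Var v)"
  by (simp add: homogeneous_def Var_def mono_degree_single)

lemma homogeneous_power:
  assumes "homogeneous k q" "n = k * l"
  shows "homogeneous n (q ^ l)"
  unfolding assms(2)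
proof (induction l)
  case 0
  show ?case by (simp add: homogeneous_one)
next
  case (Suc l)
  show ?case by (simp, rule homogeneous_mult[OF assms(1) Suc]) simp
qed

lemma homogeneous_Var_power: "homogeneous k (Var v ^ k)"
  by (rule homogeneous_power[OF homogeneous_Var]) simp

lemma homogeneous_prod:
  assumes "\<And>i. i \<in> I \<Longrightarrow> homogeneous (k i) (q i)"
  shows "homogeneous (\<Sum>i\<in>I. k i) (\<Prod>i\<in>I. q i)"
  using assms
  by (induction I rule: infinite_finite_induct)
    (auto simp: homogeneous_one intro: homogeneous_mult)

lemma homogeneous_imp_total_degree:
  assumes "homogeneous k q" "q \<noteq> 0"
  shows "total_degree q = k"
proof -
  obtain t where "t \<in> Poly_Mapping.keys q"
    using assms(2) keys_eq_empty by blast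
  with assms(1) have "mono_degree ` Poly_Mapping.keys q = {k}"
    unfolding homogeneous_def by force
  then show ?thesis by (simp add: total_degree_def)
qed

section \<open>Homogenization\<close>

lemma mono_degree_le_total_degree:
  "t \<in> Poly_Mapping.keys q \<Longrightarrow> mono_degree t \<le> total_degree q"
  by (simp add: total_degree_def)

lemma homogeneous_homogenize:
  assumes "total_degree q \<le> D"
  shows "homogeneous D (homogenize D q :: ('n::finite, 'm::finite) cvar polynomial)"
  unfolding homogenize_def
proof (rule homogeneous_sum)
  fix t assume "t \<in> Poly_Mapping.keys q"
  then have "mono_degree t \<le> D"
    using assms mono_degree_le_total_degree order_trans by blast
  moreover have "homogeneous (mono_degree t)
      (\<Prod>i\<in>UNIV. Var (VX i :: ('n, 'm) cvar) ^ Poly_Mapping.lookup t i)"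
    unfolding mono_degree_def by (intro homogeneous_prod homogeneous_Var_power)
  ultimately show "homogeneous D (Const (Poly_Mapping.lookup q t)
      * (\<Prod>i\<in>UNIV. Var (VX i :: ('n, 'm) cvar) ^ Poly_Mapping.lookup t i)
      * Var VY ^ (D - mono_degree t))"
    by (intro homogeneous_mult[OF homogeneous_mult[OF homogeneous_Const _ refl]
          homogeneous_Var_power]) (assumption, linarith)
qed

text \<open>
  A monomial \<open>x\<^sup>t\<close> is \<open>y ^ \<bar>t\<bar>\<close> times its value at \<open>x/y\<close>, so each monomial of the homogenization
  carries \<open>y\<close> to the total power \<open>\<bar>t\<bar> + (D - \<bar>t\<bar>)\<close>; this is \<open>D\<close> since the subtraction on the
  naturals does not truncate.
\<close>

lemma peval_homogenize:
  fixes q :: "'n::finite polynomial" and z :: "real ^ ('n, 'm::finite) cvar"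
  assumes "total_degree q \<le> D" and "z $ VY \<noteq> 0"
  shows "peval (homogenize D q) z = (z $ VY) ^ D * peval q (\<chi> i. z $ VX i / z $ VY)"
proof -
  let ?y = "z $ VY"
  have term_eq: "(\<Prod>i\<in>UNIV. z $ VX i ^ Poly_Mapping.lookup t i) * ?y ^ (D - mono_degree t)
      = ?y ^ D * (\<Prod>i\<in>UNIV. (z $ VX i / ?y) ^ Poly_Mapping.lookup t i)"
    if "t \<in> Poly_Mapping.keys q" for t
  proof -
    have "mono_degree t \<le> D"
      using that assms(1) mono_degree_le_total_degree order_trans by blast
    then have "?y ^ D = ?y ^ mono_degree t * ?y ^ (D - mono_degree t)"
      by (simp flip: power_add)
    moreover have "(\<Prod>i\<in>UNIV. (z $ VX i / ?y) ^ Poly_Mapping.lookup t i)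
        = (\<Prod>i\<in>UNIV. z $ VX i ^ Poly_Mapping.lookup t i) / ?y ^ mono_degree t"
      by (simp add: power_divide prod_dividef mono_degree_def power_sum)
    ultimately show ?thesis using assms(2) by simp
  qed
  have "peval (homogenize D q) z = (\<Sum>t\<in>Poly_Mapping.keys q. Poly_Mapping.lookup q t *
      ((\<Prod>i\<in>UNIV. z $ VX i ^ Poly_Mapping.lookup t i) * ?y ^ (D - mono_degree t)))"
    by (simp add: homogenize_def peval_ring_hom mult.assoc)
  also have "\<dots> = (\<Sum>t\<in>Poly_Mapping.keys q. Poly_Mapping.lookup q t *
      (?y ^ D * (\<Prod>i\<in>UNIV. (z $ VX i / ?y) ^ Poly_Mapping.lookup t i)))"
    using term_eq by simp
  also have "\<dots> = ?y ^ D * peval q (\<chi> i. z $ VX i / ?y)"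
    by (simp add: peval_def sum_distrib_left mult_ac)
  finally show ?thesis .
qed

section \<open>The certificate polynomial\<close>

lemma is_form_and_total_degree_certificate_poly:
  fixes p :: "'n::finite polynomial" and g :: "'m::finite \<Rightarrow> 'n polynomial"
  assumes d: "d \<ge> 1"
    and deg_p: "total_degree p \<le> 2 * d"
    and deg_g: "\<And>i. total_degree (g i) \<le> 2 * d"
  shows "is_form (certificate_poly d R \<eta> \<beta> p g \<gamma>)"
    and "total_degree (certificate_poly d R \<eta> \<beta> p g \<gamma>) = 4 * d"
proof -
  let ?f = "certificate_poly d R \<eta> \<beta> p g \<gamma>"
  have slack: "homogeneous (2 * d) ((Var v)\<^sup>2 * Var VY ^ (2 * d - 2))"
    for v :: "('n, 'm) cvar"
    by (rule homogeneous_mult[OF homogeneous_Var_power homogeneous_Var_power]) (use d in simp)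
  have const: "homogeneous (2 * d) (Const c * Var VY ^ (2 * d) :: ('n, 'm) cvar polynomial)" for c
    by (rule homogeneous_mult[OF homogeneous_Const homogeneous_Var_power]) simp
  have hom: "homogeneous (4 * d) ?f"
    unfolding certificate_poly_def
    by (intro homogeneous_add homogeneous_sum homogeneous_diff slack const
        homogeneous_homogenize deg_p deg_g homogeneous_Var_power
        homogeneous_power[where k = "2 * d" and l = 2] homogeneous_power[where k = 2 and l = d])
      simp_all
  then show "is_form ?f" by (auto simp: is_form_def homogeneous_def)
  \<comment> \<open>At this point only \<open>s\<^sub>m\<^sub>+\<^sub>1\<close> survives in the last square, which makes it \<open>(- 1)\<^sup>2\<close>.\<close>
  have "peval ?f (axis VSlast 1) \<ge> 1"
    using d
    by (simp add: certificate_poly_def peval_ring_hom axis_def power_0_left sum_nonneg)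
  then have "?f \<noteq> 0" by auto
  with hom show "total_degree ?f = 4 * d" by (rule homogeneous_imp_total_degree)
qed

lemma is_sos_sum_squares:
  assumes "finite I"
  shows "is_sos (a\<^sup>2 + (\<Sum>i\<in>I. (b i)\<^sup>2) + c\<^sup>2)"
proof -
  obtain xs where xs: "set xs = I" "distinct xs"
    using finite_distinct_list[OF assms] by blast
  have "a\<^sup>2 + (\<Sum>i\<in>I. (b i)\<^sup>2) + c\<^sup>2 = (\<Sum>h\<leftarrow>a # map b xs @ [c]. h\<^sup>2)"
    using xs by (simp add: comp_def sum.distinct_set_conv_list add.assoc flip: xs(1))
  then show ?thesis unfolding is_sos_def by blast
qed

text \<open>
  The value of the certificate polynomial is a sum of squares of reals, so it is positive
  unless all of them vanish. The homogenizations are left unevaluated because the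
  equivalence has to cover the case \<open>y = 0\<close>, where \<open>x/y\<close> is meaningless.
\<close>

lemma peval_certificate_poly_pos_iff:
  fixes z :: "real ^ ('n::finite, 'm::finite) cvar"
  shows "peval (certificate_poly d R \<eta> \<beta> p g \<gamma>) z > 0 \<longleftrightarrow>
    \<not> (\<gamma> * (z $ VY) ^ (2 * d) - peval (homogenize (2 * d) p) z
          = (z $ VS0)\<^sup>2 * (z $ VY) ^ (2 * d - 2)
      \<and> (\<forall>i. peval (homogenize (2 * d) (g i)) z = (z $ VS i)\<^sup>2 * (z $ VY) ^ (2 * d - 2))
      \<and> (R + (\<Sum>i\<in>UNIV. \<eta> i) + \<beta> + \<gamma>) ^ d * (z $ VY) ^ (2 * d)
          = ((\<Sum>i\<in>UNIV. (z $ VX i)\<^sup>2) + ((z $ VS0)\<^sup>2 + (\<Sum>i\<in>UNIV. (z $ VS i)\<^sup>2))) ^ d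
            + (z $ VSlast) ^ (2 * d))"
proof -
  have pos_iff: "a\<^sup>2 + (\<Sum>i\<in>UNIV. (b i)\<^sup>2) + c\<^sup>2 > 0 \<longleftrightarrow> \<not> (a = 0 \<and> (\<forall>i. b i = 0) \<and> c = 0)"
    for a c :: real and b :: "'m \<Rightarrow> real"
  proof -
    have "(\<Sum>i\<in>UNIV. (b i)\<^sup>2) \<ge> 0" by (simp add: sum_nonneg)
    moreover have "(\<Sum>i\<in>UNIV. (b i)\<^sup>2) = 0 \<longleftrightarrow> (\<forall>i. b i = 0)"
      by (simp add: sum_nonneg_eq_0_iff)
    moreover have "a\<^sup>2 \<ge> 0" "c\<^sup>2 \<ge> 0" "a\<^sup>2 = 0 \<longleftrightarrow> a = 0" "c\<^sup>2 = 0 \<longleftrightarrow> c = 0" by auto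
    ultimately show ?thesis by (smt (verit))
  qed
  show ?thesis
    unfolding certificate_poly_def peval_ring_hom peval_Const peval_Var pos_iff
    by (simp add: algebra_simps)
qed

text \<open>
  At a feasible point that violates the strict bound, the square roots of the constraint values
  complete it to a zero with \<open>y = 1\<close>; the bounds enter only to make the radicand that defines
  \<open>s\<^sub>m\<^sub>+\<^sub>1\<close> nonnegative.
\<close>

lemma certificate_poly_not_positive_definite:
  fixes p :: "'n::finite polynomial" and g :: "'m::finite \<Rightarrow> 'n polynomial"
  assumes d: "d \<ge> 1"
    and deg_p: "total_degree p \<le> 2 * d"
    and deg_g: "\<And>i. total_degree (g i) \<le> 2 * d"
    and x_ball: "norm x ^ 2 \<le> R"
    and x_feasible: "x \<in> feasible_set g"
    and g_le: "\<And>i. peval (g i) x \<le> \<eta> i"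
    and p_ge: "- peval p x \<le> \<beta>"
    and p_le: "peval p x \<le> \<gamma>"
  shows "\<not> positive_definite (certificate_poly d R \<eta> \<beta> p g \<gamma>)"
proof -
  define C where "C = R + (\<Sum>i\<in>UNIV. \<eta> i) + \<beta> + \<gamma>"
  define N where "N = (\<Sum>i\<in>UNIV. (x $ i)\<^sup>2) + ((\<gamma> - peval p x) + (\<Sum>i\<in>UNIV. peval (g i) x))"
  have g_nonneg: "peval (g i) x \<ge> 0" for i
    using x_feasible by (simp add: feasible_set_def)
  have "(\<Sum>i\<in>UNIV. (x $ i)\<^sup>2) = norm x ^ 2"
    by (simp add: norm_vec_def L2_set_def sum_nonneg)
  moreover have "(\<Sum>i\<in>UNIV. peval (g i) x) \<le> (\<Sum>i\<in>UNIV. \<eta> i)"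
    by (intro sum_mono g_le)
  ultimately have N_le: "N \<le> C"
    unfolding N_def C_def using x_ball p_ge by linarith
  have "N \<ge> 0"
    unfolding N_def using p_le by (intro add_nonneg_nonneg sum_nonneg g_nonneg) auto
  with N_le have gap: "C ^ d - N ^ d \<ge> 0"
    by (simp add: power_mono)
  define z :: "real ^ ('n, 'm) cvar" where
    "z = (\<chi> v. case v of VX i \<Rightarrow> x $ i | VS0 \<Rightarrow> sqrt (\<gamma> - peval p x)
        | VS i \<Rightarrow> sqrt (peval (g i) x) | VSlast \<Rightarrow> root (2 * d) (C ^ d - N ^ d) | VY \<Rightarrow> 1)"
  have z_simps [simp]: "z $ VX j = x $ j" "z $ VS0 = sqrt (\<gamma> - peval p x)"
      "z $ VS i = sqrt (peval (g i) x)" "z $ VSlast = root (2 * d) (C ^ d - N ^ d)" "z $ VY = 1"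
    for i j
    by (simp_all add: z_def)
  have hom_p: "peval (homogenize (2 * d) p) z = peval p x"
    by (subst peval_homogenize[OF deg_p]) simp_all
  have hom_g: "peval (homogenize (2 * d) (g i)) z = peval (g i) x" for i
    by (subst peval_homogenize[OF deg_g]) simp_all
  have last_slack: "root (2 * d) (C ^ d - N ^ d) ^ (2 * d) = C ^ d - N ^ d"
    using d gap by (intro real_root_pow_pos2) auto
  have squares: "(sqrt (peval (g i) x))\<^sup>2 = peval (g i) x"
      "(sqrt (\<gamma> - peval p x))\<^sup>2 = \<gamma> - peval p x" for i
    using g_nonneg p_le by auto
  have "\<not> peval (certificate_poly d R \<eta> \<beta> p g \<gamma>) z > 0"
    unfolding peval_certificate_poly_pos_iff z_simps hom_p hom_g last_slack squares
    by (simp flip: C_def N_def)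
  moreover have "z \<noteq> 0"
    using z_simps(5) by (metis zero_index zero_neq_one)
  ultimately show ?thesis unfolding positive_definite_def by blast
qed

lemma certificate_poly_positive_definite:
  fixes p :: "'n::finite polynomial" and g :: "'m::finite \<Rightarrow> 'n polynomial"
  assumes d: "d \<ge> 1"
    and deg_p: "total_degree p \<le> 2 * d"
    and deg_g: "\<And>i. total_degree (g i) \<le> 2 * d"
    and bound: "\<And>x. x \<in> feasible_set g \<Longrightarrow> peval p x > \<gamma>"
  shows "positive_definite (certificate_poly d R \<eta> \<beta> p g \<gamma>)"
  unfolding positive_definite_def
proof (intro allI impI, rule ccontr)
  fix z :: "real ^ ('n, 'm) cvar"
  assume z: "z \<noteq> 0" and "\<not> peval (certificate_poly d R \<eta> \<beta> p g \<gamma>) z > 0"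
  then have zero_p: "\<gamma> * (z $ VY) ^ (2 * d) - peval (homogenize (2 * d) p) z
        = (z $ VS0)\<^sup>2 * (z $ VY) ^ (2 * d - 2)"
    and zero_g: "\<And>i. peval (homogenize (2 * d) (g i)) z = (z $ VS i)\<^sup>2 * (z $ VY) ^ (2 * d - 2)"
    and zero_last: "(R + (\<Sum>i\<in>UNIV. \<eta> i) + \<beta> + \<gamma>) ^ d * (z $ VY) ^ (2 * d)
        = ((\<Sum>i\<in>UNIV. (z $ VX i)\<^sup>2) + ((z $ VS0)\<^sup>2 + (\<Sum>i\<in>UNIV. (z $ VS i)\<^sup>2))) ^ d
          + (z $ VSlast) ^ (2 * d)"
    unfolding peval_certificate_poly_pos_iff by blast+
  show False
  proof (cases "z $ VY = 0")
    case True
    let ?X = "\<Sum>i\<in>UNIV. (z $ VX i)\<^sup>2" and ?S = "\<Sum>i\<in>UNIV. (z $ VS i)\<^sup>2"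
    have nonneg: "?X \<ge> 0" "?S \<ge> 0" by (simp_all add: sum_nonneg)
    then have "(?X + ((z $ VS0)\<^sup>2 + ?S)) ^ d \<ge> 0" by simp
    moreover have "(z $ VSlast) ^ (2 * d) \<ge> 0" by simp
    moreover have "(?X + ((z $ VS0)\<^sup>2 + ?S)) ^ d + (z $ VSlast) ^ (2 * d) = 0"
      using zero_last True d by (simp add: power_0_left)
    ultimately have "(?X + ((z $ VS0)\<^sup>2 + ?S)) ^ d = 0" "(z $ VSlast) ^ (2 * d) = 0"
      by linarith+
    then have sum0: "?X + ((z $ VS0)\<^sup>2 + ?S) = 0" and last0: "z $ VSlast = 0"
      by simp_all
    have "?X = 0" "(z $ VS0)\<^sup>2 = 0" "?S = 0"
      using sum0 nonneg zero_le_power2[of "z $ VS0"] by linarith+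
    then have "z $ VX i = 0" "z $ VS0 = 0" "z $ VS j = 0" for i j
      by (simp_all add: sum_nonneg_eq_0_iff)
    then have "z $ v = 0" for v
      using last0 True by (cases v) auto
    then have "z = 0" by (simp add: vec_eq_iff)
    with z show False by contradiction
  next
    case False
    define x where "x = (\<chi> i. z $ VX i / z $ VY)"
    \<comment> \<open>Each slack square carries \<open>y ^ (2 d - 2)\<close>, so dividing by \<open>y ^ (2 d)\<close> leaves a square.\<close>
    have y_pow: "(z $ VY) ^ (2 * d) = (z $ VY)\<^sup>2 * (z $ VY) ^ (2 * d - 2)"
      unfolding power_add[symmetric] using d by (intro arg_cong[where f = "power (z $ VY)"]) linarith
    have slack: "a = (s / z $ VY)\<^sup>2"
      if "(z $ VY) ^ (2 * d) * a = s\<^sup>2 * (z $ VY) ^ (2 * d - 2)" for a s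
      using that False unfolding y_pow by (simp add: field_simps)
    have "peval (g i) x = (z $ VS i / z $ VY)\<^sup>2" for i
      using zero_g[of i] by (intro slack) (simp add: peval_homogenize[OF deg_g False] x_def)
    then have "x \<in> feasible_set g" by (simp add: feasible_set_def)
    moreover have "\<gamma> - peval p x = (z $ VS0 / z $ VY)\<^sup>2"
      using zero_p unfolding peval_homogenize[OF deg_p False] x_def[symmetric]
      by (intro slack) (simp add: algebra_simps)
    then have "peval p x \<le> \<gamma>"
      using zero_le_power2[of "z $ VS0 / z $ VY"] by linarith
    ultimately show False using bound by force
  qed
qed

theorem theorem4p2p1:
  fixes p :: "'n::finite polynomial"
    and g :: "'m::finite \<Rightarrow> 'n polynomial"
    and d :: nat
    and R \<beta> \<gamma> :: real
    and \<eta> :: "'m \<Rightarrow> real"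
  assumes "2 * d = (LEAST k. even k \<and> Max (insert (total_degree p) (range (\<lambda>i. total_degree (g i)))) \<le> k)"
    and "d \<ge> 1"
    and "R > 0"
    and "feasible_set g \<subseteq> cball 0 (sqrt R)"
    and "\<And>i x. x \<in> feasible_set g \<Longrightarrow> peval (g i) x \<le> \<eta> i"
    and "\<And>x. x \<in> feasible_set g \<Longrightarrow> - peval p x \<le> \<beta>"
  shows "is_form (certificate_poly d R \<eta> \<beta> p g \<gamma>)
    \<and> total_degree (certificate_poly d R \<eta> \<beta> p g \<gamma>) = 4 * d
    \<and> is_sos (certificate_poly d R \<eta> \<beta> p g \<gamma>)
    \<and> ((\<forall>x\<in>feasible_set g. peval p x > \<gamma>)
         \<longleftrightarrow> positive_definite (certificate_poly d R \<eta> \<beta> p g \<gamma>))"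
proof -
  let ?degs = "insert (total_degree p) (range (\<lambda>i. total_degree (g i)))"
  \<comment> \<open>The least \<open>k\<close> has the required property because some \<open>k\<close> has it.\<close>
  have "even (2 * Max ?degs) \<and> Max ?degs \<le> 2 * Max ?degs"
    by (simp del: Max_insert Max_le_iff)
  then have "even (2 * d) \<and> Max ?degs \<le> 2 * d"
    unfolding assms(1) by (rule LeastI)
  then have deg_p: "total_degree p \<le> 2 * d" and deg_g: "\<And>i. total_degree (g i) \<le> 2 * d"
    by auto
  have "positive_definite (certificate_poly d R \<eta> \<beta> p g \<gamma>)
      \<longleftrightarrow> (\<forall>x\<in>feasible_set g. peval p x > \<gamma>)"
  proof
    assume pd: "positive_definite (certificate_poly d R \<eta> \<beta> p g \<gamma>)"
    show "\<forall>x\<in>feasible_set g. peval p x > \<gamma>"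
    proof (rule ballI, rule ccontr)
      fix x assume x: "x \<in> feasible_set g" and "\<not> peval p x > \<gamma>"
      moreover have "norm x \<le> sqrt R" using x assms(4) by auto
      then have "norm x ^ 2 \<le> R"
        using \<open>R > 0\<close> power_mono[of "norm x" "sqrt R" 2] by simp
      ultimately have "\<not> positive_definite (certificate_poly d R \<eta> \<beta> p g \<gamma>)"
        using certificate_poly_not_positive_definite[of d p g, OF \<open>d \<ge> 1\<close> deg_p deg_g] assms(5,6)
        by force
      with pd show False by contradiction
    qed
  next
    assume "\<forall>x\<in>feasible_set g. peval p x > \<gamma>"
    then show "positive_definite (certificate_poly d R \<eta> \<beta> p g \<gamma>)"
      by (intro certificate_poly_positive_definite \<open>d \<ge> 1\<close> deg_p deg_g) blast
  qed
  moreover have "is_sos (certificate_poly d R \<eta> \<beta> p g \<gamma>)"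
    unfolding certificate_poly_def by (rule is_sos_sum_squares) simp
  ultimately show ?thesis
    using is_form_and_total_degree_certificate_poly[of d p g, OF \<open>d \<ge> 1\<close> deg_p deg_g] by blast
qed

end
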